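(* Let $\Pi$ be a game on a finite set $I$ of vertices and let $Q\subset I$. Define $Q^*\subset\Pi$ to be the set of edges $(i,j)\in\Pi$ such that $i\in Q$ or $j\in Q$ (or both). Let $Games(Q^* )$ be the set of games $\Gamma$ on $I$ such that $Q^*\subset\Gamma$; that is, every edge which connects to a vertex of $Q$ has the same orientation in $\Gamma$ as in $\Pi$. Then $Games(Q^* )$ is a convex subset of the interchange graph of all games on $I$.
   Context: A tournament on $I$ is a relation $\Pi\subset I\times I$ without loops such that for distinct $i,j$ exactly one of $(i,j),(j,i)$ is in $\Pi$; a game on a set $I$ of size $2n+1$ is a tournament in which every vertex has $n$ outputs and $n$ inputs. The interchange graph of games on $I$ is the undirected graph whose vertices are all games on $I$, with $\Gamma_1,\Gamma_2$ joined by an edge when $\Gamma_2=(\Gamma_1\setminus C)\cup C^{-1}$ for some $3$-cycle $C=\{(i_1,i_2),(i_2,i_3),(i_3,i_1)\}\subset\Gamma_1$ ($i_1,i_2,i_3$ distinct), where $C^{-1}=\{(j,i):(i,j)\in C\}$. A geodesic between two vertices of an undirected graph is a path of minimum length between them. A set $T$ of vertices of an undirected graph is convex when for all $t_1,t_2\in T$ there exists a geodesic of the graph between $t_1$ and $t_2$, and for every geodesic of the graph between $t_1$ and $t_2$ all of its vertices lie in $T$. *)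

theory Defs
  imports "Graph_Theory.Pair_Digraph" "Graph_Theory.Vertex_Walk"
begin

section \<open>Games and the interchange graph\<close>

definition tournament :: "'a set \<Rightarrow> 'a rel \<Rightarrow> bool" where
  "tournament I P \<longleftrightarrow>
     P \<subseteq> I \<times> I \<and> irrefl P \<and>
     (\<forall>i\<in>I. \<forall>j\<in>I. i \<noteq> j \<longrightarrow> ((i, j) \<in> P \<longleftrightarrow> (j, i) \<notin> P))"

text \<open>
  The condition \<open>card I = 2 * n + 1\<close> forces \<open>I\<close> to be finite.
\<close>

definition game :: "'a set \<Rightarrow> 'a rel \<Rightarrow> bool" where
  "game I P \<longleftrightarrow> tournament I P \<and>
     (\<exists>n. card I = 2 * n + 1 \<and>
        (\<forall>i\<in>I. card {j. (i, j) \<in> P} = n \<and> card {j. (j, i) \<in> P} = n))"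

definition three_cycle :: "'a rel \<Rightarrow> bool" where
  "three_cycle C \<longleftrightarrow>
     (\<exists>i\<^sub>1 i\<^sub>2 i\<^sub>3. distinct [i\<^sub>1, i\<^sub>2, i\<^sub>3] \<and> C = {(i\<^sub>1, i\<^sub>2), (i\<^sub>2, i\<^sub>3), (i\<^sub>3, i\<^sub>1)})"

definition interchange :: "'a rel \<Rightarrow> 'a rel \<Rightarrow> bool" where
  "interchange \<Gamma>\<^sub>1 \<Gamma>\<^sub>2 \<longleftrightarrow> (\<exists>C. three_cycle C \<and> C \<subseteq> \<Gamma>\<^sub>1 \<and> \<Gamma>\<^sub>2 = (\<Gamma>\<^sub>1 - C) \<union> C\<inverse>)"

text \<open>
  Undirected graphs are symmetric digraphs; lemma \<open>pair_graph_interchange_graph\<close> below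
  shows that this is one (finite, loopfree and symmetric).
\<close>

definition interchange_graph :: "'a set \<Rightarrow> 'a rel pair_pre_digraph" where
  "interchange_graph I =
     \<lparr> pverts = {\<Gamma>. game I \<Gamma>},
       parcs = {(\<Gamma>\<^sub>1, \<Gamma>\<^sub>2). game I \<Gamma>\<^sub>1 \<and> game I \<Gamma>\<^sub>2 \<and> interchange \<Gamma>\<^sub>1 \<Gamma>\<^sub>2} \<rparr>"

lemma tournament_asym:
  assumes "tournament I \<Gamma>" "(i, j) \<in> \<Gamma>"
  shows "(j, i) \<notin> \<Gamma>"
proof -
  have "i \<in> I" "j \<in> I" "i \<noteq> j"
    using assms by (auto simp: tournament_def irrefl_def)
  then show ?thesis
    using assms unfolding tournament_def by blast
qed

lemma interchange_sym:
  assumes "tournament I \<Gamma>\<^sub>1" "interchange \<Gamma>\<^sub>1 \<Gamma>\<^sub>2"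
  shows "interchange \<Gamma>\<^sub>2 \<Gamma>\<^sub>1"
proof -
  from assms(2) obtain C where C: "three_cycle C" "C \<subseteq> \<Gamma>\<^sub>1" "\<Gamma>\<^sub>2 = (\<Gamma>\<^sub>1 - C) \<union> C\<inverse>"
    by (auto simp: interchange_def)
  have "(j, i) \<notin> \<Gamma>\<^sub>1" if "(i, j) \<in> \<Gamma>\<^sub>1" for i j
    using tournament_asym[OF assms(1) that] .
  then have "\<Gamma>\<^sub>1 \<inter> C\<inverse> = {}"
    using C(2) by blast
  then have "\<Gamma>\<^sub>1 = (\<Gamma>\<^sub>2 - C\<inverse>) \<union> (C\<inverse>)\<inverse>" "C\<inverse> \<subseteq> \<Gamma>\<^sub>2"
    using C(2,3) by auto
  moreover have "three_cycle (C\<inverse>)"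
  proof -
    from C(1) obtain i\<^sub>1 i\<^sub>2 i\<^sub>3 where
      "distinct [i\<^sub>1, i\<^sub>2, i\<^sub>3]" "C = {(i\<^sub>1, i\<^sub>2), (i\<^sub>2, i\<^sub>3), (i\<^sub>3, i\<^sub>1)}"
      by (auto simp: three_cycle_def)
    then have "distinct [i\<^sub>3, i\<^sub>2, i\<^sub>1] \<and> C\<inverse> = {(i\<^sub>3, i\<^sub>2), (i\<^sub>2, i\<^sub>1), (i\<^sub>1, i\<^sub>3)}"
      by auto
    then show ?thesis
      unfolding three_cycle_def by blast
  qed
  ultimately show ?thesis
    unfolding interchange_def by blast
qed

lemma interchange_irrefl:
  assumes "tournament I \<Gamma>"
  shows "\<not> interchange \<Gamma> \<Gamma>"
proof
  assume "interchange \<Gamma> \<Gamma>"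
  then obtain C where C: "three_cycle C" "C \<subseteq> \<Gamma>" "\<Gamma> = (\<Gamma> - C) \<union> C\<inverse>"
    by (auto simp: interchange_def)
  from C(1) obtain i j where ij: "(i, j) \<in> C"
    by (auto simp: three_cycle_def)
  then have "(i, j) \<in> \<Gamma>" "(j, i) \<in> \<Gamma>"
    using C(2,3) by blast+
  then show False
    using tournament_asym[OF assms] by blast
qed

lemma pair_graph_interchange_graph: "pair_graph (interchange_graph I)"
proof -
  have fin: "finite {\<Gamma>. game I \<Gamma>}"
  proof (cases "finite I")
    case True
    have "{\<Gamma>. game I \<Gamma>} \<subseteq> Pow (I \<times> I)"
      by (auto simp: game_def tournament_def)
    then show ?thesis
      using True finite_subset by blast
  qed (auto simp: game_def)
  have "parcs (interchange_graph I) \<subseteq> {\<Gamma>. game I \<Gamma>} \<times> {\<Gamma>. game I \<Gamma>}"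
    by (auto simp: interchange_graph_def)
  then have "finite (parcs (interchange_graph I))"
    using fin finite_subset by blast
  moreover have "sym (parcs (interchange_graph I))"
    by (auto simp: interchange_graph_def sym_def game_def intro: interchange_sym)
  ultimately show ?thesis
    using fin
    by unfold_locales
      (auto simp: interchange_graph_def symmetric_def game_def dest: interchange_irrefl)
qed

section \<open>Geodesics and convexity\<close>

text \<open>
  A path is given by its list of vertices, and \<^const>\<open>vwalk_length\<close> counts its edges.
\<close>

definition geodesic :: "('v, 'e) pre_digraph \<Rightarrow> 'v \<Rightarrow> 'v list \<Rightarrow> 'v \<Rightarrow> bool" where
  "geodesic G u p v \<longleftrightarrow>
     vpath p G \<and> hd p = u \<and> last p = v \<and>
     (\<forall>q. vpath q G \<and> hd q = u \<and> last q = v \<longrightarrow> vwalk_length p \<le> vwalk_length q)"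

definition geodesically_convex :: "('v, 'e) pre_digraph \<Rightarrow> 'v set \<Rightarrow> bool" where
  "geodesically_convex G T \<longleftrightarrow>
     T \<subseteq> verts G \<and>
     (\<forall>t\<^sub>1\<in>T. \<forall>t\<^sub>2\<in>T.
        (\<exists>p. geodesic G t\<^sub>1 p t\<^sub>2) \<and> (\<forall>p. geodesic G t\<^sub>1 p t\<^sub>2 \<longrightarrow> set p \<subseteq> T))"

section \<open>Games with prescribed edges at a set of vertices\<close>

definition star_edges :: "'a rel \<Rightarrow> 'a set \<Rightarrow> 'a rel" where
  "star_edges P Q = {(i, j) \<in> P. i \<in> Q \<or> j \<in> Q}"

definition Games :: "'a set \<Rightarrow> 'a rel \<Rightarrow> 'a rel set" where
  "Games I S = {\<Gamma>. game I \<Gamma> \<and> S \<subseteq> \<Gamma>}"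

end

theory Submission
  imports Defs "HOL-Library.Multiset"
begin

text \<open>
  Write the difference of two games as a net flow along closed walks. The distance of two games
  in the interchange graph is the least number of oriented triangles with sum equal to this flow:
  a path is such a family of triangles, and conversely any family of closed walks with this sum
  can be turned into a path whose length is the sum of \<open>length - 2\<close> over the walks.

  If a path between two games that agree at \<open>q\<close> reverses a triangle containing \<open>q\<close>, let \<open>a\<close> be
  another vertex of that triangle and move \<open>q\<close> onto \<open>a\<close> in all triangles of the path. The sum is
  unchanged because its edges at \<open>q\<close> cancel, but the chosen triangle degenerates, so there is a
  shorter path.
\<close>

section \<open>Closed walks and their net flow\<close>

abbreviation pedges :: "'a list \<Rightarrow> ('a \<times> 'a) multiset" where
  "pedges xs \<equiv> mset (vwalk_arcs xs)"

text \<open>A closed walk is stored without the return to its first vertex, so it has as many edges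
  as its list has entries; in particular \<open>[x]\<close> carries the loop
  \<open>(x, x)\<close>.\<close>

definition cedges :: "'a list \<Rightarrow> ('a \<times> 'a) multiset" where
  "cedges xs = (case xs of [] \<Rightarrow> {#} | x # _ \<Rightarrow> pedges (xs @ [x]))"

text \<open>Counting with sign lets loops and pairs of opposite edges vanish, so degenerate walks
  carry no flow.\<close>

definition net :: "('a \<times> 'a) multiset \<Rightarrow> 'a \<Rightarrow> 'a \<Rightarrow> int" where
  "net M i j = int (count M (i, j)) - int (count M (j, i))"

abbreviation edges_of :: "'a list multiset \<Rightarrow> ('a \<times> 'a) multiset" where
  "edges_of W \<equiv> \<Sum>w\<in>#W. cedges w"

abbreviation total_length :: "'a list multiset \<Rightarrow> nat" where
  "total_length W \<equiv> \<Sum>w\<in>#W. length w"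

text \<open>A polygon with \<open>m\<close> corners is cut into \<open>m - 2\<close> triangles.
  Truncated subtraction makes walks with at most two vertices free.\<close>

abbreviation weight :: "'a list multiset \<Rightarrow> nat" where
  "weight W \<equiv> \<Sum>w\<in>#W. length w - 2"

declare vwalk_arcs_Cons [simp del]

lemma pedges_append: "pedges (xs @ y # ys) = pedges (xs @ [y]) + pedges (y # ys)"
  by (induction xs rule: vwalk_arcs.induct) auto

lemma cedges_simps [simp]: "cedges [] = {#}" "cedges (x # xs) = pedges (x # xs @ [x])"
  by (simp_all add: cedges_def)

lemma cedges_rotate: "cedges (xs @ ys) = cedges (ys @ xs)"
proof (cases xs; cases ys)
  fix x xs' y ys' assume "xs = x # xs'" "ys = y # ys'"
  then show ?thesis
    using pedges_append[of "x # xs'" y "ys' @ [x]"] pedges_append[of "y # ys'" x "xs' @ [y]"]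
    by simp
qed auto

lemma in_vwalk_arcsE:
  assumes "(a, b) \<in> set (vwalk_arcs xs)"
  obtains us vs where "xs = us @ a # b # vs"
proof -
  have "\<exists>us vs. xs = us @ a # b # vs"
    using assms
  proof (induction xs rule: vwalk_arcs.induct)
    case (3 x y zs)
    show ?case
    proof (cases "(a, b) = (x, y)")
      case True
      then show ?thesis by (metis append_Nil prod.inject)
    next
      case False
      then obtain us vs where "y # zs = us @ a # b # vs"
        using 3 by auto
      then show ?thesis by (metis append_Cons)
    qed
  qed auto
  then show ?thesis using that by blast
qed

text \<open>Rotation brings a chosen edge to the front. Loops are excluded because the loop of
  \<open>[a]\<close> does not come from two list entries.\<close>

lemma in_cedgesE:
  assumes "(a, b) \<in># cedges w" "a \<noteq> b"
  obtains zs where "cedges w = cedges (a # b # zs)" "length w = length (a # b # zs)"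
proof -
  obtain x xs where w: "w = x # xs"
    using assms(1) by (cases w) auto
  then have "(a, b) \<in> set (vwalk_arcs (x # xs @ [x]))"
    using assms(1) by simp
  then obtain us vs where uv: "x # xs @ [x] = us @ a # b # vs"
    by (rule in_vwalk_arcsE)
  show ?thesis
  proof (cases vs rule: rev_cases)
    \<comment> \<open>Here the chosen edge is the closing one, so \<open>b\<close> is the first
      vertex of \<open>w\<close>.\<close>
    case Nil
    then have "(us @ [a]) @ [b] = w @ [x]"
      unfolding w using uv[symmetric] by (simp only: append_assoc append.simps)
    then have *: "w = us @ [a]" "b = x"
      unfolding append1_eq_conv by blast+
    then obtain us' where us': "us = b # us'"
      using w assms(2) by (cases us) auto
    show ?thesis
    proof (rule that)
      show "cedges w = cedges (a # b # us')"
        unfolding * us' using cedges_rotate[of "b # us'" "[a]"] * by (simp only: append.simps)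
      show "length w = length (a # b # us')"
        by (simp add: * us')
    qed
  next
    case (snoc vs' v)
    then have "(us @ a # b # vs') @ [v] = w @ [x]"
      unfolding w using uv[symmetric] by (simp only: append_assoc append.simps)
    then have *: "w = us @ a # b # vs'"
      unfolding append1_eq_conv by blast
    show ?thesis
    proof (rule that)
      show "cedges w = cedges (a # b # vs' @ us)"
        unfolding * using cedges_rotate[of us "a # b # vs'"] by (simp only: append.simps)
      show "length w = length (a # b # vs' @ us)"
        by (simp add: *)
    qed
  qed
qed

section \<open>Cancellation in the net flow\<close>

lemma net_empty [simp]: "net {#} i j = 0"
  by (simp add: net_def)

lemma net_plus [simp]: "net (M + N) i j = net M i j + net N i j"
  by (simp add: net_def)

lemma net_add_mset:
  "net (add_mset e M) i j = of_bool (e = (i, j)) - of_bool (e = (j, i)) + net M i j"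
proof -
  have count: "int (count (add_mset e M) p) = of_bool (e = p) + int (count M p)" for p
    by simp
  show ?thesis
    unfolding net_def count by (rule add_diff_add)
qed

lemma net_loop: "net (add_mset (a, a) M) = net M"
  by (rule ext)+ (simp add: net_add_mset conj_commute)

lemma net_opposite: "net (add_mset (a, b) (add_mset (b, a) M)) = net M"
  by (rule ext)+ (simp add: net_add_mset conj_commute)

text \<open>
  Cancelling two opposite edges merges two closed walks or splits one; neither operation
  increases the total of \<open>length - 2\<close>.
\<close>

lemma cancel_opposite:
  assumes "(b, a) \<in># edges_of (add_mset (a # b # xs) R)"
  obtains W where "net (edges_of W) = net (edges_of (add_mset (a # b # xs) R))"
    "total_length W < total_length (add_mset (a # b # xs) R)"
    "weight W \<le> weight (add_mset (a # b # xs) R)"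
proof (cases "a = b")
  case True
  show ?thesis
    by (rule that[of "add_mset (b # xs) R"]) (simp_all add: True net_loop)
next
  case False
  consider "(b, a) \<in># cedges (a # b # xs)" | "(b, a) \<in># edges_of R"
    using assms by auto
  then show ?thesis
  proof cases
    case 1
    then have "(b, a) \<in> set (vwalk_arcs (b # xs @ [a]))"
      using False by simp
    then obtain us vs where uv: "b # xs @ [a] = us @ b # a # vs"
      by (rule in_vwalk_arcsE)
    \<comment> \<open>\<open>us\<close> is empty or starts with \<open>b\<close>, so continuing it
      to the next \<open>b\<close> closes it.\<close>
    have us: "pedges (us @ [b]) = cedges us"
      using uv by (cases us) auto
    show ?thesis
    proof (cases vs rule: rev_cases)
      case Nil
      \<comment> \<open>The opposite edge closes the walk; removing both edges leaves the single
        closed walk \<open>us\<close>.\<close>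
      then have "(b # xs) @ [a] = (us @ [b]) @ [a]"
        using uv by simp
      then have "b # xs = us @ [b]"
        by (simp only: append1_eq_conv)
      then have "length xs = length us"
        by (metis length_Cons length_append_singleton nat.inject)
      have "cedges (a # b # xs) = add_mset (a, b) (pedges (us @ [b, a]))"
        by (simp flip: uv[unfolded Nil])
      then have "edges_of (add_mset (a # b # xs) R)
          = add_mset (a, b) (add_mset (b, a) (edges_of (add_mset us R)))"
        using pedges_append[of us b "[a]"] by (simp add: us)
      with \<open>length xs = length us\<close> show ?thesis
        by (intro that[of "add_mset us R"]) (simp_all only: net_opposite, simp_all)
    next
      case (snoc vs' v)
      \<comment> \<open>Removing the two edges leaves two closed walks, \<open>us\<close> and
        \<open>a # vs'\<close>.\<close>
      then have "(b # xs) @ [a] = (us @ b # a # vs') @ [v]"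
        using uv by simp
      then have vs': "b # xs = us @ b # a # vs'" "v = a"
        unfolding append1_eq_conv by blast+
      have len: "length xs = length us + length vs' + 1"
        using arg_cong[where f = length, OF vs'(1)] by simp
      have "cedges (a # b # xs) = add_mset (a, b) (pedges (us @ b # a # vs' @ [a]))"
        by (simp flip: uv[unfolded snoc \<open>v = a\<close>])
      then have "edges_of (add_mset (a # b # xs) R)
          = add_mset (a, b) (add_mset (b, a) (edges_of (add_mset us (add_mset (a # vs') R))))"
        using pedges_append[of us b "a # vs' @ [a]"] by (simp add: us)
      with len show ?thesis
        by (intro that[of "add_mset us (add_mset (a # vs') R)"])
          (simp_all only: net_opposite, simp_all)
    qed
  next
    case 2
    then obtain v R' where R: "R = add_mset v R'" and "(b, a) \<in># cedges v"
      by (auto dest!: multi_member_split)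
    then obtain ys where ys: "cedges v = cedges (b # a # ys)" "length v = length (b # a # ys)"
      using False by (auto elim!: in_cedgesE)
    \<comment> \<open>The two walks are glued along the cancelled edge: two vertices are lost and
      one walk disappears, so the weight is unchanged.\<close>
    have "edges_of (add_mset (a # b # xs) R)
        = add_mset (a, b) (add_mset (b, a) (edges_of (add_mset (b # xs @ a # ys) R')))"
      using R ys(1) pedges_append[of "b # xs" a "ys @ [b]"] by simp
    with R ys(2) show ?thesis
      by (intro that[of "add_mset (b # xs @ a # ys) R'"]) (simp_all only: net_opposite, simp_all)
  qed
qed

section \<open>Reversing a triangle of a game\<close>

lemma game_tournament: "game I G \<Longrightarrow> tournament I G"
  by (simp only: game_def)

lemma tournament_mem: "tournament I G \<Longrightarrow> (i, j) \<in> G \<Longrightarrow> i \<in> I \<and> j \<in> I \<and> i \<noteq> j"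
  unfolding tournament_def irrefl_def by blast

lemma tournament_total:
  "tournament I G \<Longrightarrow> i \<in> I \<Longrightarrow> j \<in> I \<Longrightarrow> i \<noteq> j \<Longrightarrow> (i, j) \<notin> G \<Longrightarrow> (j, i) \<in> G"
  unfolding tournament_def by blast

lemma game_finite: "game I G \<Longrightarrow> finite I"
  unfolding game_def using card.infinite[of I] by force

lemma finite_neighbours:
  assumes "game I G"
  shows "finite {j. (i, j) \<in> G}" "finite {j. (j, i) \<in> G}"
  using tournament_mem[OF game_tournament[OF assms]] game_finite[OF assms]
  by (blast intro: finite_subset)+

text \<open>Each corner of the triangle exchanges one output for another and one input for another,
  so all degrees survive the reversal.\<close>

lemma interchange_graph_step:
  fixes G :: "'a rel"
  assumes "game I G" "(x, y) \<in> G" "(y, z) \<in> G" "(z, x) \<in> G"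
  obtains H where "(G, H) \<in> parcs (interchange_graph I)"
    and "H = G - {(x, y), (y, z), (z, x)} \<union> {(y, x), (z, y), (x, z)}"
proof -
  let ?C = "{(x, y), (y, z), (z, x)}"
  define H where "H = G - ?C \<union> {(y, x), (z, y), (x, z)}"
  note T = game_tournament[OF assms(1)]
  have d: "x \<noteq> y" "y \<noteq> z" "z \<noteq> x"
    using assms(2-4) tournament_mem[OF T] by blast+
  have mem: "x \<in> I" "y \<in> I" "z \<in> I"
    using assms(2-4) tournament_mem[OF T] by blast+
  have opp: "(y, x) \<notin> G" "(z, y) \<notin> G" "(x, z) \<notin> G"
    using assms(2-4) tournament_asym[OF T] by blast+
  obtain n where n: "card I = 2 * n + 1"
    "\<And>i. i \<in> I \<Longrightarrow> card {j. (i, j) \<in> G} = n \<and> card {j. (j, i) \<in> G} = n"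
    using assms(1) unfolding game_def by blast
  have swap: "card (insert b (A - {a})) = card A" if "finite A" "a \<in> A" "b \<notin> A" for A and a b :: 'a
  proof -
    have "card (insert b (A - {a})) = Suc (card (A - {a}))"
      by (rule card_insert_disjoint) (use that in auto)
    then show ?thesis
      using that card_Suc_Diff1[of A a] by simp
  qed
  have cards: "card {j. (i, j) \<in> H} = card {j. (i, j) \<in> G} \<and> card {j. (j, i) \<in> H} = card {j. (j, i) \<in> G}"
    if "i \<in> I" for i
  proof -
    consider "i = x" | "i = y" | "i = z" | "i \<notin> {x, y, z}" by blast
    then show ?thesis
    proof cases
      case 1
      then have "{j. (i, j) \<in> H} = insert z ({j. (i, j) \<in> G} - {y})"
        "{j. (j, i) \<in> H} = insert y ({j. (j, i) \<in> G} - {z})"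
        using d unfolding H_def by blast+
      then show ?thesis
        by (simp only:) (intro conjI swap; use 1 opp assms(2-4) finite_neighbours[OF assms(1)] in simp)
    next
      case 2
      then have "{j. (i, j) \<in> H} = insert x ({j. (i, j) \<in> G} - {z})"
        "{j. (j, i) \<in> H} = insert z ({j. (j, i) \<in> G} - {x})"
        using d unfolding H_def by blast+
      then show ?thesis
        by (simp only:) (intro conjI swap; use 2 opp assms(2-4) finite_neighbours[OF assms(1)] in simp)
    next
      case 3
      then have "{j. (i, j) \<in> H} = insert y ({j. (i, j) \<in> G} - {x})"
        "{j. (j, i) \<in> H} = insert x ({j. (j, i) \<in> G} - {y})"
        using d unfolding H_def by blast+
      then show ?thesis
        by (simp only:) (intro conjI swap; use 3 opp assms(2-4) finite_neighbours[OF assms(1)] in simp)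
    next
      case 4
      then have "{j. (i, j) \<in> H} = {j. (i, j) \<in> G}" "{j. (j, i) \<in> H} = {j. (j, i) \<in> G}"
        unfolding H_def by blast+
      then show ?thesis by simp
    qed
  qed
  have HC: "H = G - ?C \<union> ?C\<inverse>"
    unfolding H_def by blast
  have "tournament I H"
    unfolding tournament_def
  proof (intro conjI ballI impI)
    show "H \<subseteq> I \<times> I"
      unfolding H_def using tournament_mem[OF T] mem by auto
    show "irrefl H"
      unfolding H_def irrefl_def using tournament_mem[OF T] d by blast
    fix i j assume "i \<in> I" "j \<in> I" "i \<noteq> j"
    then have "(i, j) \<in> G \<longleftrightarrow> (j, i) \<notin> G"
      using tournament_total[OF T] tournament_asym[OF T] by blast
    moreover have "?C \<subseteq> G"
      using assms(2-4) by blast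
    ultimately show "(i, j) \<in> H \<longleftrightarrow> (j, i) \<notin> H"
      unfolding HC by blast
  qed
  then have "game I H"
    unfolding game_def using n cards by auto
  moreover have "interchange G H"
    unfolding interchange_def three_cycle_def HC using d assms(2-4)
    by (intro exI[of _ ?C] conjI exI[of _ x] exI[of _ y] exI[of _ z]) auto
  ultimately have "(G, H) \<in> parcs (interchange_graph I)"
    using assms(1) by (simp add: interchange_graph_def)
  then show ?thesis
    by (rule that) (rule H_def)
qed

text \<open>For tournaments on the same vertices this function is antisymmetric, hence comparable
  with \<open>net\<close>: it is the flow that a path from \<open>G\<close> to \<open>H\<close> has
  to reverse.\<close>

definition diff :: "'a rel \<Rightarrow> 'a rel \<Rightarrow> 'a \<Rightarrow> 'a \<Rightarrow> int" where
  "diff G H i j = of_bool ((i, j) \<in> G) - of_bool ((i, j) \<in> H)"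

lemma diff_chain: "diff G H i j + diff H K i j = diff G K i j"
  by (simp add: diff_def)

lemma net_mset_set:
  "finite C \<Longrightarrow> net (mset_set C) i j = of_bool ((i, j) \<in> C) - of_bool ((j, i) \<in> C)"
  by (simp add: net_def count_mset_set')

text \<open>This ties edges of the interchange graph to triangles: one reversal accounts for exactly
  the flow of the reversed triangle.\<close>

lemma diff_step:
  assumes "tournament I G" "(x, y) \<in> G" "(y, z) \<in> G" "(z, x) \<in> G"
    and "H = G - {(x, y), (y, z), (z, x)} \<union> {(y, x), (z, y), (x, z)}"
  shows "diff G H = net (cedges [x, y, z])"
proof (rule ext)+
  fix i j
  define C where "C = {(x, y), (y, z), (z, x)}"
  have "x \<noteq> y" "y \<noteq> z" "z \<noteq> x"
    using assms(2-4) tournament_mem[OF assms(1)] by blast+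
  then have "cedges [x, y, z] = mset_set C"
    by (simp add: C_def)
  moreover have "finite C"
    by (simp add: C_def)
  ultimately have net: "net (cedges [x, y, z]) i j = of_bool ((i, j) \<in> C) - of_bool ((j, i) \<in> C)"
    by (simp only: net_mset_set)
  have "C \<subseteq> G" "H = G - C \<union> C\<inverse>"
    using assms(2-5) unfolding C_def by blast+
  then have "(i, j) \<in> H \<longleftrightarrow> (i, j) \<in> G \<and> (i, j) \<notin> C \<or> (j, i) \<in> C"
    "(i, j) \<in> C \<Longrightarrow> (i, j) \<in> G" "(j, i) \<in> C \<Longrightarrow> (i, j) \<notin> G"
    using tournament_asym[OF assms(1)] by blast+
  then show "diff G H i j = net (cedges [x, y, z]) i j"
    unfolding net diff_def
    by (cases "(i, j) \<in> C"; cases "(j, i) \<in> C"; cases "(i, j) \<in> G") simp_all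
qed

section \<open>From closed walks to paths of games\<close>

text \<open>With no opposite edge to cancel it, \<open>(i, j)\<close> has positive net flow, and
  \<open>diff\<close> is positive only on edges of \<open>G\<close> outside
  \<open>H\<close>.\<close>

lemma edge_realised:
  assumes "diff G H = net M" "(i, j) \<in># M" "(j, i) \<notin># M"
  shows "(i, j) \<in> G" "(i, j) \<notin> H"
proof -
  have "count M (j, i) = 0" "count M (i, j) > 0"
    using assms(2,3) by (simp_all add: count_eq_zero_iff)
  then have "diff G H i j > 0"
    unfolding assms(1) net_def by linarith
  then show "(i, j) \<in> G" "(i, j) \<notin> H"
    by (cases "(i, j) \<in> G"; cases "(i, j) \<in> H"; simp add: diff_def)+
qed

lemma edges_of_empty: "total_length W = 0 \<Longrightarrow> edges_of W = {#}"
  by (induction W) auto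

text \<open>Inserting the chord between \<open>x\<close> and \<open>z\<close> in both directions
  changes no flow and splits the walk.\<close>

lemma net_cut_triangle:
  "net (cedges (x # y # z # r)) i j = net (cedges [x, y, z]) i j + net (cedges (x # z # r)) i j"
proof -
  have "add_mset (x, z) (add_mset (z, x) (cedges (x # y # z # r))) = cedges [x, y, z] + cedges (x # z # r)"
    by simp
  then show ?thesis
    using net_opposite[of x z "cedges (x # y # z # r)"] by (metis net_plus)
qed

lemma net_reverse_triangle: "net (cedges [x, z, y]) i j = - net (cedges [x, y, z]) i j"
  by (simp add: net_add_mset conj_commute)

lemma interchange_graph_game:
  "(G, H) \<in> parcs (interchange_graph I) \<Longrightarrow> game I G \<and> game I H"
  by (simp add: interchange_graph_def)

lemma interchange_graph_sym:
  "(G, H) \<in> parcs (interchange_graph I) \<Longrightarrow> (H, G) \<in> parcs (interchange_graph I)"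
  by (auto simp: interchange_graph_def intro: interchange_sym game_tournament)

text \<open>
  Outer induction on the total length, inner induction on the length of a designated walk
  \<open>x y z \<dots>\<close>. Once \<open>x y\<close> and \<open>y z\<close> cannot be cancelled, they are edges of \<open>G\<close> reversed in \<open>H\<close>,
  and the triangle \<open>x y z\<close> can be reversed first in \<open>G\<close> or last in \<open>H\<close>, unless the chord
  \<open>x z\<close> itself belongs to \<open>G - H\<close>. Then some walk uses this chord, and exchanging \<open>x z\<close>
  with \<open>x y z\<close> shortens the designated walk.
\<close>

lemma filling_path:
  assumes "game I G" "game I H" "diff G H = net (edges_of W)"
  shows "\<exists>k \<le> weight W. (G, H) \<in> parcs (interchange_graph I) ^^ k"
  using assms
proof (induction "total_length W" arbitrary: W G H rule: less_induct)
  case less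
  note shorter = less.hyps and games = less.prems(1,2)
  note T = game_tournament[OF games(1)] game_tournament[OF games(2)]
  show ?case
  proof (cases "total_length W = 0")
    case True
    then have "diff G H i j = 0" for i j
      using less.prems(3) by (simp add: edges_of_empty)
    then have "(i, j) \<in> G \<longleftrightarrow> (i, j) \<in> H" for i j
      unfolding diff_def right_minus_eq of_bool_eq_iff .
    then have "G = H" by auto
    then have "(G, H) \<in> parcs (interchange_graph I) ^^ 0" by simp
    then show ?thesis by blast
  next
    case False
    then obtain w where "w \<in># W" "w \<noteq> []"
      by auto
    then obtain R where W: "W = add_mset w R"
      by (meson mset_add)
    \<comment> \<open>The total length is held fixed while \<open>w\<close> and \<open>R\<close>
      vary, so the outer hypothesis \<open>shorter\<close> stays available throughout the inner
      induction.\<close>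
    have "\<exists>k \<le> weight (add_mset w R). (G, H) \<in> parcs (interchange_graph I) ^^ k"
      if "w \<noteq> []" "diff G H = net (edges_of (add_mset w R))"
        "total_length (add_mset w R) = total_length W" for w R
      using that
    proof (induction "length w" arbitrary: w R rule: less_induct)
      case (less w R)
      note shorter_first = less.hyps and D = less.prems(2) and len = less.prems(3)
      \<comment> \<open>If the opposite of an edge of \<open>w\<close> occurs anywhere, cancelling
        the pair lowers the total length and the outer induction applies.\<close>
      have cancel: ?case if ab: "cedges w = cedges (a # b # xs)" "length w = length (a # b # xs)"
        "(b, a) \<in># edges_of (add_mset w R)" for a b xs
      proof -
        have eq: "edges_of (add_mset w R) = edges_of (add_mset (a # b # xs) R)"
          "total_length (add_mset w R) = total_length (add_mset (a # b # xs) R)"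
          "weight (add_mset w R) = weight (add_mset (a # b # xs) R)"
          using ab(1,2) by simp_all
        obtain W' where W': "net (edges_of W') = net (edges_of (add_mset w R))"
          "total_length W' < total_length W" "weight W' \<le> weight (add_mset w R)"
          using cancel_opposite[of b a xs R] ab(3) unfolding eq len[symmetric] by blast
        from shorter[OF W'(2) games] D W'(1) obtain k where
          "k \<le> weight W'" "(G, H) \<in> parcs (interchange_graph I) ^^ k" by auto
        then show ?thesis
          using W'(3) le_trans by blast
      qed
      consider x where "w = [x]" | x y where "w = [x, y]" | x y z r where "w = x # y # z # r"
        using less.prems(1) by (metis neq_Nil_conv)
      then show ?case
      proof cases
        case 1
        have "total_length R < total_length W" "diff G H = net (edges_of R)"
          using D unfolding len[symmetric] by (simp_all add: 1 net_loop)
        from shorter[OF this(1) games this(2)] show ?thesis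
          by (simp add: 1)
      next
        case 2
        \<comment> \<open>The closing edge of a two-vertex walk is opposite to its first
          edge.\<close>
        show ?thesis
          by (rule cancel[of x y "[]"]) (simp_all add: 2)
      next
        case 3
        let ?M = "edges_of (add_mset w R)"
        \<comment> \<open>Rotating puts the edge \<open>(y, z)\<close> in front, as
          \<open>cancel\<close> requires.\<close>
        have rot: "cedges w = cedges (y # z # r @ [x])"
          using cedges_rotate[of "[x]" "y # z # r"] by (simp only: 3 append.simps)
        show ?thesis
        proof (cases "(y, x) \<in># ?M \<or> (z, y) \<in># ?M")
          case True
          then show ?thesis
            using cancel[of x y "z # r"] cancel[of y z "r @ [x]"] rot
            by (auto simp only: 3 length_Cons length_append_singleton)
        next
          case False
          have in_M: "(x, y) \<in># ?M" "(y, z) \<in># ?M"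
            by (simp_all add: 3)
          have xy: "(x, y) \<in> G" "(x, y) \<notin> H" and yz: "(y, z) \<in> G" "(y, z) \<notin> H"
            using edge_realised[OF D] in_M False by blast+
          have mem: "x \<in> I" "y \<in> I" "z \<in> I" "x \<noteq> y" "y \<noteq> z"
            using tournament_mem[OF T(1)] xy yz by blast+
          have yx: "(y, x) \<in> H" and zy: "(z, y) \<in> H"
            using tournament_total[OF T(2)] mem xy yz by blast+
          \<comment> \<open>Otherwise \<open>(y, z)\<close> would be the opposite of
            \<open>(x, y)\<close>.\<close>
          have "x \<noteq> z"
            using False in_M by blast
          \<comment> \<open>Cutting off the triangle lowers the weight by exactly one, which pays
            for one interchange.\<close>
          let ?W = "add_mset (x # z # r) R"
          have W': "total_length ?W < total_length W" "weight (add_mset w R) = Suc (weight ?W)"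
            unfolding len[symmetric] by (simp_all add: 3)
          have cut: "diff G H i j = net (cedges [x, y, z]) i j + net (edges_of ?W) i j" for i j
            using net_cut_triangle[of x y z r i j]
            by (simp only: D 3 image_mset_add_mset sum_mset.add_mset net_plus add.assoc)
          consider "(z, x) \<in> G" | "(x, z) \<in> H" | "(x, z) \<in> G" "(x, z) \<notin> H"
            using tournament_total[OF T(1)] mem \<open>x \<noteq> z\<close> by blast
          then show ?thesis
          proof cases
            case 1
            from interchange_graph_step[OF games(1) xy(1) yz(1) 1] obtain G' where
              G': "(G, G') \<in> parcs (interchange_graph I)"
              "G' = G - {(x, y), (y, z), (z, x)} \<union> {(y, x), (z, y), (x, z)}" by blast
            have "diff G' H i j = net (edges_of ?W) i j" for i j
              using cut[of i j] diff_chain[of G G' i j H] diff_step[OF T(1) xy(1) yz(1) 1 G'(2)]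
              by simp
            then have "diff G' H = net (edges_of ?W)" by blast
            from shorter[OF W'(1) _ games(2) this] G'(1) obtain k where
              "k \<le> weight ?W" "(G', H) \<in> parcs (interchange_graph I) ^^ k"
              using interchange_graph_game by blast
            then have "Suc k \<le> weight (add_mset w R)"
              "(G, H) \<in> parcs (interchange_graph I) ^^ Suc k"
              using relpow_Suc_I2[OF G'(1)] W'(2) by simp_all
            then show ?thesis by blast
          next
            case 2
            \<comment> \<open>\<open>H\<close> contains the triangle in the opposite direction;
              reversing it yields the predecessor \<open>H'\<close> of \<open>H\<close> on the
              path.\<close>
            from interchange_graph_step[OF games(2) 2 zy yx] obtain H' where
              H': "(H, H') \<in> parcs (interchange_graph I)"
              "H' = H - {(x, z), (z, y), (y, x)} \<union> {(z, x), (y, z), (x, y)}" by blast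
            have "diff G H' i j = net (edges_of ?W) i j" for i j
              using cut[of i j] diff_chain[of G H i j H'] diff_step[OF T(2) 2 zy yx H'(2)]
                net_reverse_triangle[of x z y i j]
              by simp
            then have "diff G H' = net (edges_of ?W)" by blast
            from shorter[OF W'(1) games(1) _ this] H'(1) obtain k where
              "k \<le> weight ?W" "(G, H') \<in> parcs (interchange_graph I) ^^ k"
              using interchange_graph_game by blast
            then have "Suc k \<le> weight (add_mset w R)"
              "(G, H) \<in> parcs (interchange_graph I) ^^ Suc k"
              using relpow_Suc_I[OF _ interchange_graph_sym[OF H'(1)]] W'(2) by simp_all
            then show ?thesis by blast
          next
            case 3
            \<comment> \<open>Positive flow along the chord forces some walk of the filling to use
              it.\<close>
            have "diff G H x z = 1"
              using 3 by (simp add: diff_def)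
            then have "count ?M (x, z) > 0"
              unfolding D net_def by linarith
            then consider "(x, z) \<in># cedges w" | "(x, z) \<in># edges_of R"
              by auto
            then show ?thesis
            proof cases
              case 1
              then have "(x, z) \<in> set (vwalk_arcs (z # r @ [x]))"
                using mem by (simp add: \<open>w = x # y # z # r\<close>)
              then obtain us vs where uv: "z # r @ [x] = us @ x # z # vs"
                by (rule in_vwalk_arcsE)
              obtain us' where us: "us = z # us'"
                using uv \<open>x \<noteq> z\<close> by (cases us) auto
              obtain vs' where vs: "vs = vs' @ [x]"
                using uv \<open>x \<noteq> z\<close> us by (cases vs rule: rev_cases) auto
              have r: "r = us' @ x # z # vs'"
                using uv by (simp add: us vs)
              \<comment> \<open>\<open>w\<close> passes through \<open>x\<close> twice and splits
                there into two closed walks with the same edges; the one starting with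
                \<open>x y z\<close> is designated next.\<close>
              have "edges_of (add_mset w R)
                  = edges_of (add_mset (x # y # z # us') (add_mset (x # z # vs') R))"
                using pedges_append[of "x # y # z # us'" x "z # vs' @ [x]"]
                by (simp add: \<open>w = x # y # z # r\<close> r add.assoc)
              with D have "diff G H = net (edges_of (add_mset (x # y # z # us') (add_mset (x # z # vs') R)))"
                by (simp only:)
              then have "\<exists>k \<le> weight (add_mset (x # y # z # us') (add_mset (x # z # vs') R)).
                  (G, H) \<in> parcs (interchange_graph I) ^^ k"
                using len
                by (intro shorter_first) (simp_all add: \<open>w = x # y # z # r\<close> r)
              moreover have "weight (add_mset (x # y # z # us') (add_mset (x # z # vs') R))
                  \<le> weight (add_mset w R)"
                by (simp add: \<open>w = x # y # z # r\<close> r)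
              ultimately show ?thesis
                using le_trans by blast
            next
              case 2
              then obtain v R' where R: "R = add_mset v R'" and "(x, z) \<in># cedges v"
                by (auto dest!: multi_member_split)
              then obtain s where s: "cedges v = cedges (x # z # s)" "length v = length (x # z # s)"
                using \<open>x \<noteq> z\<close> by (auto elim!: in_cedgesE)
              \<comment> \<open>The other walk takes over the detour through \<open>y\<close> and
                gives its chord to the designated walk, which becomes
                \<open>x # z # r\<close>.\<close>
              have "edges_of (add_mset w R) = edges_of (add_mset (x # z # r) (add_mset (x # y # z # s) R'))"
                by (simp add: \<open>w = x # y # z # r\<close> R s(1))
              with D have "diff G H = net (edges_of (add_mset (x # z # r) (add_mset (x # y # z # s) R')))"
                by (simp only:)
              then have "\<exists>k \<le> weight (add_mset (x # z # r) (add_mset (x # y # z # s) R')).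
                  (G, H) \<in> parcs (interchange_graph I) ^^ k"
                using len s(2)
                by (intro shorter_first) (simp_all add: \<open>w = x # y # z # r\<close> R)
              then show ?thesis
                by (simp add: \<open>w = x # y # z # r\<close> R s(2))
            qed
          qed
        qed
      qed
    qed
    then show ?thesis
      using W \<open>w \<noteq> []\<close> less.prems(3) by blast
  qed
qed

section \<open>Collapsing a vertex\<close>

lemma net_swap: "net M j i = - net M i j"
  by (simp add: net_def)

lemma net_zero_not_in: "(i, j) \<notin># M \<Longrightarrow> (j, i) \<notin># M \<Longrightarrow> net M i j = 0"
  unfolding net_def by (metis count_eq_zero_iff cancel_comm_monoid_add_class.diff_cancel)

lemma in_cedges_set: "(i, j) \<in># cedges w \<Longrightarrow> i \<in> set w \<and> j \<in> set w"
  using arcs_in_vwalk_arcs[of "(i, j)" "w @ [hd w]"] by (cases w) auto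

text \<open>Two equal corners leave a loop and a pair of opposite edges.\<close>

lemma net_degenerate_triangle:
  assumes "\<not> distinct [x, y, z]"
  shows "net (cedges [x, y, z]) i j = 0"
proof -
  consider "x = y" | "z = x" | "y = z"
    using assms by auto
  then show ?thesis
  proof cases
    case 3
    have "cedges [x, z, z] = add_mset (z, z) (add_mset (x, z) (add_mset (z, x) {#}))"
      by simp
    then show ?thesis
      unfolding 3 by (simp only: net_loop net_opposite net_empty)
  qed (simp_all add: net_loop net_opposite)
qed

text \<open>Each interchange contributes its triangle, and the differences of consecutive games
  telescope.\<close>

lemma path_filling:
  assumes "(G, H) \<in> parcs (interchange_graph I) ^^ k"
  shows "\<exists>W. size W = k \<and> (\<forall>w\<in>#W. length w = 3 \<and> distinct w) \<and> diff G H = net (edges_of W)"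
  using assms
proof (induction k arbitrary: H)
  case 0
  then have "diff G H = net (edges_of {#})"
    by (simp add: diff_def fun_eq_iff)
  then show ?case
    by (intro exI[of _ "{#}"]) simp
next
  case (Suc k)
  from Suc.prems obtain K where K: "(G, K) \<in> parcs (interchange_graph I) ^^ k"
    "(K, H) \<in> parcs (interchange_graph I)" by auto
  from Suc.IH[OF K(1)] obtain W where W: "size W = k" "\<forall>w\<in>#W. length w = 3 \<and> distinct w"
    "diff G K = net (edges_of W)" by blast
  have T: "tournament I K"
    using interchange_graph_game[OF K(2)] game_tournament by blast
  from K(2) obtain x y z where xyz: "distinct [x, y, z]" "(x, y) \<in> K" "(y, z) \<in> K" "(z, x) \<in> K"
    "H = (K - {(x, y), (y, z), (z, x)}) \<union> {(x, y), (y, z), (z, x)}\<inverse>"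
    unfolding interchange_graph_def interchange_def three_cycle_def by auto
  have "H = K - {(x, y), (y, z), (z, x)} \<union> {(y, x), (z, y), (x, z)}"
    unfolding xyz(5) by blast
  from diff_step[OF T xyz(2-4) this]
  have "diff G H i j = net (edges_of (add_mset [x, y, z] W)) i j" for i j
    using diff_chain[of G K i j H]
    by (simp only: W(3) image_mset_add_mset sum_mset.add_mset net_plus add.commute)
  then show ?case
    using W(1,2) xyz(1) by (intro exI[of _ "add_mset [x, y, z] W"]) (auto simp: fun_eq_iff)
qed

text \<open>Moving \<open>q\<close> onto \<open>a\<close> adds the flow at \<open>q\<close> to the
  flow at \<open>a\<close>, and the former is zero.\<close>

lemma net_image_collapse:
  assumes "a \<noteq> q" and zero: "\<And>j. net M q j = 0"
  shows "net (image_mset (map_prod (id(q := a)) (id(q := a))) M) = net M"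
proof (rule ext)+
  fix i j
  let ?f = "map_prod (id(q := a)) (id(q := a))"
  have zero': "net M i q = 0" for i
    using zero net_swap[of M q i] by simp
  show "net (image_mset ?f M) i j = net M i j"
  proof (cases "i = q \<or> j = q")
    case True
    \<comment> \<open>After the move no edge touches \<open>q\<close>.\<close>
    then have "(i, j) \<notin># image_mset ?f M" "(j, i) \<notin># image_mset ?f M"
      using assms(1) by (auto split: if_splits)
    then show ?thesis
      using True zero zero' net_zero_not_in by metis
  next
    case False
    then have ne: "i \<noteq> q" "j \<noteq> q" by auto
    \<comment> \<open>Parts of \<open>M\<close> may have flow at \<open>q\<close>, so the induction
      carries correction terms, which vanish only for \<open>M\<close> itself.\<close>
    have "net (image_mset ?f N) i j = net N i j + of_bool (i = a) * net N q j + of_bool (j = a) * net N i q"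
      for N
    proof (induction N)
      case empty
      show ?case by simp
    next
      case (add e N)
      obtain u v where e: "e = (u, v)" by (cases e)
      show ?case
        using ne assms(1) add.IH
        by (cases "u = q"; cases "v = q"; cases "i = a"; cases "j = a") (simp_all add: e net_add_mset)
    qed
    then show ?thesis
      using zero zero' by simp
  qed
qed

lemma cedges_map: "cedges (map f w) = image_mset (map_prod f f) (cedges w)"
proof -
  have "vwalk_arcs (map f xs) = map (map_prod f f) (vwalk_arcs xs)" for xs
    by (induction xs rule: vwalk_arcs.induct) auto
  from this[of "w @ [hd w]"] show ?thesis
    by (cases w) (simp_all flip: mset_map)
qed

text \<open>Collapsing \<open>q\<close> onto another corner of \<open>w\<close> makes
  \<open>w\<close> degenerate, so the remaining \<open>size W - 1\<close> triangles still fill the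
  difference; \<open>filling_path\<close> turns them into a walk of games.\<close>

lemma shortcut:
  assumes "game I G" "game I H" "diff G H = net (edges_of W)"
    and triangles: "\<And>w. w \<in># W \<Longrightarrow> length w = 3 \<and> distinct w"
    and "w \<in># W" "q \<in> set w" and zero: "\<And>j. diff G H q j = 0"
  shows "\<exists>k < size W. (G, H) \<in> parcs (interchange_graph I) ^^ k"
proof -
  obtain R where W: "W = add_mset w R"
    using assms(5) by (metis mset_add)
  obtain x y z where w: "w = [x, y, z]" "distinct [x, y, z]"
    using triangles[OF assms(5)] by (auto simp: numeral_3_eq_3 length_Suc_conv)
  obtain a where a: "a \<in> set w" "a \<noteq> q"
    using w by (cases "x = q") auto
  define f where "f = id(q := a)"
  define R' where "R' = image_mset (map f) R"
  have edges: "edges_of (image_mset (map f) V) = image_mset (map_prod f f) (edges_of V)" for V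
    by (induction V) (simp_all add: cedges_map)
  have "diff G H = net (image_mset (map_prod f f) (edges_of W))"
    unfolding assms(3) f_def using a(2) zero unfolding assms(3) by (rule net_image_collapse[symmetric])
  also have "\<dots> = net (edges_of (image_mset (map f) W))"
    by (simp only: edges)
  also have "\<dots> = net (edges_of (add_mset [f x, f y, f z] R'))"
    by (simp only: W R'_def w(1) list.map image_mset_add_mset)
  also have "\<dots> = net (edges_of R')"
  proof (rule ext)+
    fix i j
    have "\<not> distinct [f x, f y, f z]"
      using a assms(6) w unfolding f_def by auto
    from net_degenerate_triangle[OF this, of i j]
    show "net (edges_of (add_mset [f x, f y, f z] R')) i j = net (edges_of R') i j"
      by (simp only: image_mset_add_mset sum_mset.add_mset net_plus add_0)
  qed
  finally obtain k where "k \<le> weight R'" "(G, H) \<in> parcs (interchange_graph I) ^^ k"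
    using filling_path[OF assms(1,2)] by blast
  moreover have "weight R' = size R"
  proof -
    \<comment> \<open>Other triangles may degenerate too, but their lists keep length 3, and the
      weight depends on nothing else.\<close>
    have "length v = 3" if "v \<in># R'" for v
      using that triangles unfolding R'_def W by auto
    then have "weight R' = size R'"
      by (induction R') auto
    then show ?thesis by (simp add: R'_def)
  qed
  ultimately show ?thesis
    using W by (metis le_imp_less_Suc size_add_mset)
qed

section \<open>Connectedness of the interchange graph\<close>

lemma card_game_neighbours:
  assumes "game I G" "game I H"
  shows "card {j. (i, j) \<in> G} = card {j. (i, j) \<in> H}"
proof (cases "i \<in> I")
  case True
  obtain m n where "card I = 2 * m + 1" "card {j. (i, j) \<in> G} = m"
    "card I = 2 * n + 1" "card {j. (i, j) \<in> H} = n"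
    using assms True unfolding game_def by blast
  then show ?thesis by simp
next
  case False
  then have "{j. (i, j) \<in> G} = {}" "{j. (i, j) \<in> H} = {}"
    using tournament_mem[OF game_tournament[OF assms(1)], of i]
      tournament_mem[OF game_tournament[OF assms(2)], of i] by auto
  then show ?thesis by simp
qed

text \<open>
  The cone over \<open>G - H\<close> with an arbitrary apex is a filling: its spokes cancel because every
  vertex has as many outputs as inputs in \<open>G - H\<close>.
\<close>

lemma games_connected:
  assumes "game I G" "game I H"
  shows "\<exists>k. (G, H) \<in> parcs (interchange_graph I) ^^ k"
proof -
  note T = assms[THEN game_tournament]
  define D where "D = G - H"
  fix c :: 'a
  define W where "W = image_mset (\<lambda>(u, v). [c, u, v]) (mset_set D)"
  have "finite D"
    unfolding D_def using T(1) game_finite[OF assms(1)]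
    by (auto simp only: tournament_def intro: finite_subset finite_SigmaI finite_Diff)
  have balanced: "image_mset fst (mset_set D) = image_mset snd (mset_set D)"
  proof (rule multiset_eqI)
    fix x
    let ?A = "{j. (x, j) \<in> G}" and ?B = "{j. (x, j) \<in> H}"
    have "{e \<in> D. fst e = x} = Pair x ` (?A - ?B)"
      unfolding D_def by force
    then have fst: "card {e \<in> D. fst e = x} = card (?A - ?B)"
      by (simp add: card_image inj_on_def)
    \<comment> \<open>Inputs of \<open>x\<close> in \<open>G - H\<close> are outputs of
      \<open>x\<close> in \<open>H - G\<close>. Since \<open>?A\<close> and \<open>?B\<close> have
      equal size, so do their two differences.\<close>
    have "(j, x) \<in> G \<and> (j, x) \<notin> H \<longleftrightarrow> (x, j) \<in> H \<and> (x, j) \<notin> G" for j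
      using tournament_mem[OF T(1)] tournament_mem[OF T(2)] tournament_asym[OF T(1)]
        tournament_asym[OF T(2)] tournament_total[OF T(1)] tournament_total[OF T(2)] by metis
    then have "{e \<in> D. snd e = x} = (\<lambda>j. (j, x)) ` (?B - ?A)"
      unfolding D_def by force
    then have "card {e \<in> D. snd e = x} = card (?B - ?A)"
      by (simp add: card_image inj_on_def)
    also have "\<dots> = card (?A - ?B)"
      using card_game_neighbours[OF assms, of x] finite_neighbours[OF assms(1)] finite_neighbours[OF assms(2)]
      by (simp add: card_Diff_subset_Int Int_commute)
    finally show "count (image_mset fst (mset_set D)) x = count (image_mset snd (mset_set D)) x"
      using \<open>finite D\<close> fst by (simp add: count_image_mset_eq_card_vimage)
  qed
  have spokes: "net (image_mset (Pair c) N + image_mset (\<lambda>x. (x, c)) N) i j = 0" for N i j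
    by (induction N) (simp_all add: net_opposite)
  \<comment> \<open>The cone consists of its base, the spokes out to all tails and the spokes back
    from all heads.\<close>
  have split: "edges_of (image_mset (\<lambda>(u, v). [c, u, v]) N)
      = N + (image_mset (Pair c) (image_mset fst N) + image_mset (\<lambda>x. (x, c)) (image_mset snd N))" for N
    by (induction N) auto
  have "diff G H i j = net (edges_of W) i j" for i j
  proof -
    have "(j, i) \<in> D \<longleftrightarrow> (i, j) \<in> H \<and> (i, j) \<notin> G"
      unfolding D_def using tournament_mem[OF T(1)] tournament_mem[OF T(2)] tournament_asym[OF T(1)]
        tournament_asym[OF T(2)] tournament_total[OF T(1)] tournament_total[OF T(2)] by blast
    moreover have "(i, j) \<in> D \<longleftrightarrow> (i, j) \<in> G \<and> (i, j) \<notin> H"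
      unfolding D_def by blast
    ultimately have "diff G H i j = net (mset_set D) i j"
      unfolding diff_def net_mset_set[OF \<open>finite D\<close>] by auto
    then show ?thesis
      unfolding W_def split balanced using spokes by simp
  qed
  then show ?thesis
    using filling_path[OF assms, of W] by blast
qed

section \<open>Geodesics\<close>

lemma relpow_vwalk:
  assumes "(u, v) \<in> parcs G ^^ k" "u \<in> pverts G" "pair_wf_digraph G"
  shows "\<exists>p. vwalk p (with_proj G) \<and> hd p = u \<and> last p = v \<and> length p = Suc k"
  using assms(1,2)
proof (induction k arbitrary: u)
  case 0
  then show ?case
    by (intro exI[of _ "[u]"]) (auto intro: vwalkI)
next
  case (Suc k)
  from relpow_Suc_D2[OF Suc.prems(1)]
  obtain t where t: "(u, t) \<in> parcs G" "(t, v) \<in> parcs G ^^ k"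
    by blast
  then have "t \<in> pverts G"
    using assms(3) by (auto dest: pair_wf_digraph.in_arcsD2)
  with Suc.IH t(2) obtain p where "vwalk p (with_proj G)" "hd p = t" "last p = v" "length p = Suc k"
    by blast
  moreover from this t(1) Suc.prems(2) have "vwalk (u # p) (with_proj G)"
    by (intro vwalk_consI) simp_all
  ultimately show ?case
    by (intro exI[of _ "u # p"]) (auto simp: vwalk_def)
qed

lemma vwalk_relpow:
  assumes "vwalk p (with_proj G)"
  shows "(hd p, last p) \<in> parcs G ^^ (length p - 1)"
  using assms
  by (induction p rule: vwalk_induct) (auto intro: relpow_Suc_I2 simp del: relpow.simps(2))

lemma length_vwalk_to_vpath: "length (vwalk_to_vpath p) \<le> length p"
  by (induction p rule: vwalk_to_vpath_induct3)
    (auto intro: le_trans le_SucI length_dropWhile_le)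

text \<open>Fillings produce walks, whereas geodesics are compared with paths; removing the cycles
  of a walk does not lengthen it.\<close>

lemma relpow_vpath:
  assumes "(u, v) \<in> parcs G ^^ k" "u \<in> pverts G" "pair_wf_digraph G"
  obtains p where "vpath p (with_proj G)" "hd p = u" "last p = v" "vwalk_length p \<le> k"
proof -
  obtain p where p: "vwalk p (with_proj G)" "hd p = u" "last p = v" "length p = Suc k"
    using relpow_vwalk[OF assms] by blast
  show ?thesis
    by (rule that[OF vwalk_to_vpath_vpath[OF p(1)]])
      (use p length_vwalk_to_vpath[of p] in \<open>auto simp: vwalk_to_vpath_hd vwalk_to_vpath_last\<close>)
qed

text \<open>All edges of \<open>P\<close> at \<open>q\<close>, in both directions, lie in
  \<open>\<Gamma>\<close>, and a tournament has no room for further edges at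
  \<open>q\<close>.\<close>

lemma Games_star_iff:
  assumes "game I P" "Q \<subseteq> I" "\<Gamma> \<in> Games I (star_edges P Q)" "q \<in> Q"
  shows "(q, j) \<in> \<Gamma> \<longleftrightarrow> (q, j) \<in> P"
proof -
  have T: "tournament I \<Gamma>" "tournament I P" and sub: "star_edges P Q \<subseteq> \<Gamma>"
    using assms(1,3) game_tournament unfolding Games_def by blast+
  have "(q, j) \<in> P \<Longrightarrow> (q, j) \<in> \<Gamma>" "(j, q) \<in> P \<Longrightarrow> (j, q) \<in> \<Gamma>"
    using sub assms(4) unfolding star_edges_def by blast+
  then show ?thesis
    using T tournament_mem tournament_total tournament_asym by metis
qed

theorem theorem8p2:
  fixes I Q :: "'a set" and P :: "'a rel"
  assumes "finite I" and "game I P" and "Q \<subseteq> I"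
  shows "geodesically_convex (with_proj (interchange_graph I)) (Games I (star_edges P Q))"
  unfolding geodesically_convex_def
proof (intro conjI ballI allI impI)
  let ?E = "parcs (interchange_graph I)"
  interpret pair_graph "interchange_graph I"
    by (rule pair_graph_interchange_graph)
  have verts: "pverts (interchange_graph I) = {\<Gamma>. game I \<Gamma>}"
    by (simp add: interchange_graph_def)
  show "Games I (star_edges P Q) \<subseteq> verts (with_proj (interchange_graph I))"
    by (auto simp: verts Games_def)
  fix G H assume GH: "G \<in> Games I (star_edges P Q)" "H \<in> Games I (star_edges P Q)"
  then have games: "game I G" "game I H"
    by (simp_all add: Games_def)
  have "G \<in> pverts (interchange_graph I)"
    using games(1) by (simp add: verts)
  note to_vpath = relpow_vpath[OF _ this pair_wf_digraph_axioms]
  show "\<exists>p. geodesic (with_proj (interchange_graph I)) G p H"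
  proof -
    \<comment> \<open>\<open>k\<close> is the least length of a walk; some path is no longer, and no
      path is shorter since paths are walks.\<close>
    define k where "k = (LEAST k. (G, H) \<in> ?E ^^ k)"
    have "(G, H) \<in> ?E ^^ k"
      unfolding k_def using games_connected[OF games] by (rule LeastI_ex)
    from to_vpath[OF this] obtain p where
      p: "vpath p (with_proj (interchange_graph I))" "hd p = G" "last p = H" "vwalk_length p \<le> k"
      by blast
    have "k \<le> vwalk_length q"
      if "vpath q (with_proj (interchange_graph I))" "hd q = G" "last q = H" for q
      unfolding k_def using vwalk_relpow[of q "interchange_graph I"] that
      by (intro Least_le) (auto simp: vpath_def)
    then have "geodesic (with_proj (interchange_graph I)) G p H"
      unfolding geodesic_def using p le_trans by blast
    then show ?thesis by blast
  qed
  fix p assume p: "geodesic (with_proj (interchange_graph I)) G p H"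
  have shortest: "length p - 1 \<le> k" if "(G, H) \<in> ?E ^^ k" for k
  proof -
    from to_vpath[OF that] obtain q where
      "vpath q (with_proj (interchange_graph I))" "hd q = G" "last q = H" "vwalk_length q \<le> k"
      by blast
    then show ?thesis
      using p le_trans unfolding geodesic_def vwalk_length_simp by blast
  qed
  show "set p \<subseteq> Games I (star_edges P Q)"
  proof
    fix K assume "K \<in> set p"
    then obtain p\<^sub>1 p\<^sub>2 where split: "p = p\<^sub>1 @ K # p\<^sub>2"
      by (meson split_list)
    have walk: "vwalk p (with_proj (interchange_graph I))" "hd p = G" "last p = H"
      using p unfolding geodesic_def vpath_def by blast+
    have "game I K"
      using vwalk_verts_in_verts[OF walk(1) \<open>K \<in> set p\<close>] by (simp add: verts)
    moreover have "(i, j) \<in> K" if "(i, j) \<in> star_edges P Q" for i j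
    proof (rule ccontr)
      assume "(i, j) \<notin> K"
      \<comment> \<open>The geodesic is cut at \<open>K\<close>, and each half is turned into
        triangles, one for each of its edges.\<close>
      have "vwalk (p\<^sub>1 @ [K]) (with_proj (interchange_graph I))"
        "vwalk (K # p\<^sub>2) (with_proj (interchange_graph I))"
        using walk(1) vwalkI_append_l[of "p\<^sub>1 @ [K]" p\<^sub>2] vwalkI_append_r[of "K # p\<^sub>2" p\<^sub>1]
        unfolding split by simp_all
      from this[THEN vwalk_relpow]
      have "(G, K) \<in> ?E ^^ length p\<^sub>1" "(K, H) \<in> ?E ^^ length p\<^sub>2"
        using walk(2,3) unfolding split by (auto simp: hd_append split: if_splits)
      from this[THEN path_filling] obtain W\<^sub>1 W\<^sub>2 where
        W\<^sub>1: "size W\<^sub>1 = length p\<^sub>1" "\<forall>w\<in>#W\<^sub>1. length w = 3 \<and> distinct w" "diff G K = net (edges_of W\<^sub>1)" and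
        W\<^sub>2: "size W\<^sub>2 = length p\<^sub>2" "\<forall>w\<in>#W\<^sub>2. length w = 3 \<and> distinct w" "diff K H = net (edges_of W\<^sub>2)"
        by blast
      have "(i, j) \<in> G"
        using GH(1) that unfolding Games_def by blast
      \<comment> \<open>The edge is lost between \<open>G\<close> and \<open>K\<close>, so a
        triangle of the first half contains both \<open>i\<close> and \<open>j\<close>, hence a
        vertex of \<open>Q\<close>.\<close>
      then have "net (edges_of W\<^sub>1) i j \<noteq> 0"
        using \<open>(i, j) \<notin> K\<close> by (simp add: diff_def flip: W\<^sub>1(3))
      then have "(i, j) \<in># edges_of W\<^sub>1 \<or> (j, i) \<in># edges_of W\<^sub>1"
        using net_zero_not_in[of i j "edges_of W\<^sub>1"] by satx
      then obtain w where "w \<in># W\<^sub>1" and "(i, j) \<in># cedges w \<or> (j, i) \<in># cedges w"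
        by auto
      then have "i \<in> set w" "j \<in> set w"
        using in_cedges_set[of i j w] in_cedges_set[of j i w] by auto
      then obtain q where q: "q \<in> Q" "q \<in> set w"
        using \<open>(i, j) \<in> star_edges P Q\<close> unfolding star_edges_def by blast
      \<comment> \<open>Both ends of the geodesic agree with \<open>P\<close> at \<open>q\<close>,
        so the flow there is zero and \<open>q\<close> can be collapsed.\<close>
      have "diff G H q l = 0" for l
        using Games_star_iff[OF assms(2,3) _ q(1)] GH by (simp add: diff_def)
      moreover have "diff G H l m = net (edges_of (W\<^sub>1 + W\<^sub>2)) l m" for l m
        using diff_chain[of G K l m H]
        by (simp only: W\<^sub>1(3) W\<^sub>2(3) image_mset_union sum_mset.union net_plus)
      then have "diff G H = net (edges_of (W\<^sub>1 + W\<^sub>2))" by blast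
      ultimately obtain k where k: "k < size (W\<^sub>1 + W\<^sub>2)" "(G, H) \<in> ?E ^^ k"
        using shortcut[OF games, of "W\<^sub>1 + W\<^sub>2" w q] W\<^sub>1(2) W\<^sub>2(2) \<open>w \<in># W\<^sub>1\<close> q(2) by auto
      \<comment> \<open>The two halves together have \<open>length p - 1\<close> triangles, the
        number of edges of the geodesic, so the shortcut beats it.\<close>
      from shortest[OF k(2)] k(1) show False
        by (simp add: split W\<^sub>1(1) W\<^sub>2(1))
    qed
    ultimately show "K \<in> Games I (star_edges P Q)"
      unfolding Games_def by auto
  qed
qed

end
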